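(* If $G$ is a graph of order $n\geq2$, then $$\chi_{2}^{f}(G)+\chi_{2}^{f}(\overline{G})\leq \dfrac{3n}{2}.$$ Moreover, equality holds if and only if $n$ is even and $G$ is isomorphic to $K_{1,n-1}$ or to $\overline{K_{1,n-1}}$.
   Context: All graphs are finite and simple; $\overline{G}$ denotes the complement of $G$, and $K_{1,n-1}$ is the star on $n$ vertices. A $2$-frugal coloring of $G$ is a proper vertex coloring in which no color appears more than twice in the (open) neighborhood of any vertex; $\chi_2^f(G)$ is the minimum number of colors in a $2$-frugal coloring of $G$. *)

theory Defs
  imports Complex_Main "Graph_Theory.Pair_Digraph" "Graph_Theory.Digraph_Isomorphism"
begin

text \<open>
  A finite simple graph is a structure satisfying the locale predicate \<open>pair_graph\<close>, where an
  edge \<open>uv\<close> is represented by the two arcs \<open>(u, v)\<close> and \<open>(v, u)\<close>.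
\<close>

definition graph_complement :: "'a pair_pre_digraph \<Rightarrow> 'a pair_pre_digraph" where
  "graph_complement G =
     \<lparr> pverts = pverts G,
       parcs = {(u, v). u \<in> pverts G \<and> v \<in> pverts G \<and> u \<noteq> v \<and> (u, v) \<notin> parcs G} \<rparr>"

definition neighborhood :: "'a pair_pre_digraph \<Rightarrow> 'a \<Rightarrow> 'a set" where
  "neighborhood G v = {u \<in> pverts G. (v, u) \<in> parcs G}"

definition proper_coloring :: "'a pair_pre_digraph \<Rightarrow> ('a \<Rightarrow> 'c) \<Rightarrow> bool" where
  "proper_coloring G c \<longleftrightarrow> (\<forall>(u, v) \<in> parcs G. c u \<noteq> c v)"

definition two_frugal_coloring :: "'a pair_pre_digraph \<Rightarrow> ('a \<Rightarrow> 'c) \<Rightarrow> bool" where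
  "two_frugal_coloring G c \<longleftrightarrow>
     proper_coloring G c \<and>
     (\<forall>v \<in> pverts G. \<forall>i. card {u \<in> neighborhood G v. c u = i} \<le> 2)"

definition two_frugal_chromatic_number :: "'a pair_pre_digraph \<Rightarrow> nat" where
  "two_frugal_chromatic_number G =
     (LEAST k. \<exists>c :: 'a \<Rightarrow> nat. two_frugal_coloring G c \<and> card (c ` pverts G) = k)"

text \<open>\<open>star_graph m\<close> is $K_{1,m}$, of order \<open>m + 1\<close>, with centre \<open>0\<close>.\<close>

definition star_graph :: "nat \<Rightarrow> nat pair_pre_digraph" where
  "star_graph m = \<lparr> pverts = {0..m}, parcs = {0} \<times> {1..m} \<union> {1..m} \<times> {0} \<rparr>"

abbreviation graph_isomorphic :: "'a pair_pre_digraph \<Rightarrow> 'b pair_pre_digraph \<Rightarrow> bool" where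
  "graph_isomorphic G H \<equiv> digraph_iso (with_proj G) (with_proj H)"

lemma pair_graph_complement:
  assumes "pair_graph G"
  shows "pair_graph (graph_complement G)"
proof -
  interpret pair_graph G by fact
  have "parcs (graph_complement G) \<subseteq> pverts G \<times> pverts G"
    by (auto simp: graph_complement_def)
  then have "finite (parcs (graph_complement G))"
    using pair_finite_verts by (meson finite_SigmaI finite_subset)
  moreover have "(u, v) \<in> parcs G \<longleftrightarrow> (v, u) \<in> parcs G" for u v
    using sym_arcs by (auto simp: symmetric_def sym_def)
  ultimately show ?thesis
    using pair_finite_verts
    by unfold_locales (auto simp: graph_complement_def symmetric_def sym_def)
qed

lemma pair_graph_star: "pair_graph (star_graph m)"
  by unfold_locales (auto simp: star_graph_def symmetric_def sym_def)

lemma two_frugal_chromatic_number_attained: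
  fixes G :: "'a pair_pre_digraph"
  assumes "pair_graph G"
  shows "\<exists>c :: 'a \<Rightarrow> nat. two_frugal_coloring G c \<and>
           card (c ` pverts G) = two_frugal_chromatic_number G"
proof -
  interpret pair_graph G by fact
  obtain c :: "'a \<Rightarrow> nat" where inj: "inj_on c (pverts G)"
    using finite_imp_inj_to_nat_seg[OF pair_finite_verts] by blast
  have "card {u \<in> neighborhood G v. c u = i} \<le> 2" for v i
  proof -
    have "inj_on c {u \<in> neighborhood G v. c u = i}"
      by (rule inj_on_subset[OF inj]) (auto simp: neighborhood_def)
    then have "card {u \<in> neighborhood G v. c u = i} \<le> card {i}"
      by (rule card_inj_on_le) auto
    then show ?thesis by simp
  qed
  moreover have "proper_coloring G c"
    unfolding proper_coloring_def
  proof clarify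
    fix u v assume "(u, v) \<in> parcs G" "c u = c v"
    then show False
      using inj_onD[OF inj] in_arcsD1 in_arcsD2 pair_no_loops[of "(u, v)"] by simp
  qed
  ultimately have "\<exists>c :: 'a \<Rightarrow> nat. two_frugal_coloring G c \<and> card (c ` pverts G) = card (c ` pverts G)"
    by (auto simp: two_frugal_coloring_def)
  then have "\<exists>k. \<exists>c :: 'a \<Rightarrow> nat. two_frugal_coloring G c \<and> card (c ` pverts G) = k"
    by blast
  then show ?thesis
    unfolding two_frugal_chromatic_number_def by (rule LeastI_ex)
qed

lemma graph_isomorphic_iff:
  assumes "pair_graph G" "pair_graph H"
  shows "graph_isomorphic G H \<longleftrightarrow>
    (\<exists>f. bij_betw f (pverts G) (pverts H) \<and>
       (\<forall>u \<in> pverts G. \<forall>v \<in> pverts G. (u, v) \<in> parcs G \<longleftrightarrow> (f u, f v) \<in> parcs H))"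
    (is "?L \<longleftrightarrow> ?R")
proof
  interpret G: pair_graph G by fact
  interpret H: pair_graph H by fact
  show ?R if ?L
  proof -
    obtain h where h: "pre_digraph.digraph_isomorphism (with_proj G) h"
      and H: "with_proj H = app_iso h (with_proj G)"
      using \<open>?L\<close> by (auto simp: digraph_iso_def)
    define f where "f = iso_verts h"
    have V: "pverts H = f ` pverts G" and A: "parcs H = iso_arcs h ` parcs G"
      and T: "fst = iso_tail h" and D: "snd = iso_head h"
      using arg_cong[OF H, of verts] arg_cong[OF H, of arcs] arg_cong[OF H, of tail]
        arg_cong[OF H, of head] by (simp_all add: f_def)
    have inj: "inj_on f (pverts G)"
      and "\<And>a. a \<in> parcs G \<Longrightarrow> f (fst a) = fst (iso_arcs h a) \<and> f (snd a) = snd (iso_arcs h a)"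
      using h unfolding pre_digraph.digraph_isomorphism_def by (auto simp: f_def T D)
    then have "iso_arcs h a = map_prod f f a" if "a \<in> parcs G" for a
      using that by (simp add: prod_eq_iff)
    then have A': "parcs H = map_prod f f ` parcs G"
      using A by auto
    have "(u, v) \<in> parcs G \<longleftrightarrow> (f u, f v) \<in> parcs H" if "u \<in> pverts G" "v \<in> pverts G" for u v
    proof
      assume "(u, v) \<in> parcs G"
      then show "(f u, f v) \<in> parcs H"
        unfolding A' by (intro image_eqI[of _ _ "(u, v)"]) simp_all
    next
      assume "(f u, f v) \<in> parcs H"
      then obtain x y where xy: "(x, y) \<in> parcs G" "f x = f u" "f y = f v"
        unfolding A' by auto
      then show "(u, v) \<in> parcs G"
        using inj_onD[OF inj] that G.in_arcsD1[OF xy(1)] G.in_arcsD2[OF xy(1)] by metis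
    qed
    then show ?R
      using inj V by (auto simp: bij_betw_def)
  qed
  show ?L if ?R
  proof -
    obtain f where f: "bij_betw f (pverts G) (pverts H)"
      and e: "\<And>u v. u \<in> pverts G \<Longrightarrow> v \<in> pverts G \<Longrightarrow> (u, v) \<in> parcs G \<longleftrightarrow> (f u, f v) \<in> parcs H"
      using \<open>?R\<close> by blast
    have inj: "inj_on f (pverts G)" and V: "pverts H = f ` pverts G"
      using f by (auto simp: bij_betw_def)
    let ?h = "\<lparr> iso_verts = f, iso_arcs = map_prod f f, iso_head = snd, iso_tail = fst \<rparr>"
    have "parcs H \<subseteq> map_prod f f ` parcs G"
    proof
      fix a assume "a \<in> parcs H"
      obtain x y where a: "a = (x, y)" by (cases a)
      have "x \<in> f ` pverts G" "y \<in> f ` pverts G"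
        using H.in_arcsD1 H.in_arcsD2 \<open>a \<in> parcs H\<close> a V by auto
      then obtain u v where uv: "u \<in> pverts G" "v \<in> pverts G" "x = f u" "y = f v"
        by blast
      then have "(u, v) \<in> parcs G"
        using \<open>a \<in> parcs H\<close> a e by simp
      then show "a \<in> map_prod f f ` parcs G"
        using a uv by (intro image_eqI[of _ _ "(u, v)"]) simp_all
    qed
    moreover have "map_prod f f ` parcs G \<subseteq> parcs H"
    proof (rule image_subsetI)
      fix a assume "a \<in> parcs G"
      then show "map_prod f f a \<in> parcs H"
        using e[of "fst a" "snd a"] G.arc_fst_in_verts[of a] G.arc_snd_in_verts[of a]
        by (simp add: map_prod_def case_prod_beta)
    qed
    ultimately have "with_proj H = app_iso ?h (with_proj G)"
      using V by (auto simp: app_iso_def with_proj_def)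
    moreover have "inj_on (map_prod f f) (parcs G)"
    proof (rule inj_onI)
      fix a b assume "a \<in> parcs G" "b \<in> parcs G" "map_prod f f a = map_prod f f b"
      then show "a = b"
        using inj_onD[OF inj, of "fst a" "fst b"] inj_onD[OF inj, of "snd a" "snd b"]
        by (simp add: prod_eq_iff G.arc_fst_in_verts G.arc_snd_in_verts)
    qed
    then have "pre_digraph.digraph_isomorphism (with_proj G) ?h"
      using inj G.wf_digraph_axioms unfolding pre_digraph.digraph_isomorphism_def by simp
    ultimately show ?L
      unfolding digraph_iso_def by blast
  qed
qed

end

theory Submission
  imports Defs
begin

text \<open>
  Two vertices that are adjacent in the complement of \<open>G\<close> may share a colour in \<open>G\<close>, and a colour
  used at most twice can never violate 2-frugality. Hence a matching with \<open>m\<close> edges in the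
  complement yields a 2-frugal colouring of \<open>G\<close> with \<open>n - m\<close> colours
  (\<open>two_frugal_chromatic_number_matching\<close>), and the sum in question is at most \<open>2 * n - (a + b)\<close>
  whenever \<open>G\<close> has a matching of size \<open>a\<close> and its complement one of size \<open>b\<close>. What remains is a
  question on matchings in the two colours of a red-blue coloured complete graph: red for the
  edges of \<open>G\<close>, blue for those of the complement.

  Removing an arbitrary pair of vertices, which is an edge of one of the colours, gives
  \<open>2 * (a + b) \<ge> n - 1\<close> by induction. If both colours occur, some vertex \<open>v\<close> has a red edge \<open>vx\<close>
  and a blue edge \<open>vy\<close>. Removing \<open>v\<close>, \<open>x\<close> and \<open>y\<close> costs three vertices but pays for one edge in
  each matching, because the two matchings may share vertices. This gains enough to show
  \<open>2 * (a + b) \<ge> n + 1\<close> for odd \<open>n\<close>, and likewise for even \<open>n\<close> unless the \<open>n - 3\<close> remaining vertices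
  span a single colour. In the latter case nearly perfect matchings of that colour are at hand, and
  the absence of a better pair of matchings forces every edge: one of the two colours is a
  spanning star (\<open>mixed_large_matchings_even\<close>).

  So the sum is below \<open>3 * n / 2\<close> unless \<open>G\<close> is complete, edgeless, or (for even \<open>n\<close>) a star or the
  complement of one. An edgeless graph needs a single colour, so the first two cases give at most
  \<open>n + 1\<close>, which is below \<open>3 * n / 2\<close> for \<open>n > 2\<close>; for \<open>n = 2\<close> both graphs are of star type.
  Finally a star with an even number \<open>n\<close> of vertices attains the bound: its \<open>n - 1\<close> leaves are
  neighbours of the centre, so need \<open>n / 2\<close> colours besides that of the centre, and they form a
  clique in the complement, which therefore needs \<open>n - 1\<close> colours.
\<close>

section \<open>Matchings in the two colours of a complete graph\<close>

text \<open>
  The recursion on the size makes removing an edge together with its ends, the step of every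
  induction below, part of the definition. Only pairs of distinct vertices are ever inspected, so
  the values of \<open>E\<close> on the diagonal are irrelevant. This allows the second colour to be plain
  negation, \<open>\<lambda>u v. \<not> E u v\<close>, with the two colours playing symmetric roles.
\<close>

primrec has_matching :: "('a \<Rightarrow> 'a \<Rightarrow> bool) \<Rightarrow> nat \<Rightarrow> 'a set \<Rightarrow> bool" where
  "has_matching E 0 W \<longleftrightarrow> True"
| "has_matching E (Suc m) W \<longleftrightarrow>
     (\<exists>u\<in>W. \<exists>v\<in>W. u \<noteq> v \<and> E u v \<and> has_matching E m (W - {u, v}))"

definition spanning_clique :: "('a \<Rightarrow> 'a \<Rightarrow> bool) \<Rightarrow> 'a set \<Rightarrow> bool" where
  "spanning_clique E W \<longleftrightarrow> (\<forall>u\<in>W. \<forall>v\<in>W. u \<noteq> v \<longrightarrow> E u v)"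

definition spanning_star :: "('a \<Rightarrow> 'a \<Rightarrow> bool) \<Rightarrow> 'a set \<Rightarrow> bool" where
  "spanning_star E W \<longleftrightarrow> (\<exists>z\<in>W. \<forall>u\<in>W. \<forall>v\<in>W. u \<noteq> v \<longrightarrow> (E u v \<longleftrightarrow> u = z \<or> v = z))"

definition has_two_matchings :: "('a \<Rightarrow> 'a \<Rightarrow> bool) \<Rightarrow> nat \<Rightarrow> 'a set \<Rightarrow> bool" where
  "has_two_matchings E k W \<longleftrightarrow>
     (\<exists>a b. a + b = k \<and> has_matching E a W \<and> has_matching (\<lambda>u v. \<not> E u v) b W)"

lemma has_matching_mono:
  assumes "has_matching E m W" "W \<subseteq> X"
    and "\<And>u v. u \<in> W \<Longrightarrow> v \<in> W \<Longrightarrow> u \<noteq> v \<Longrightarrow> E u v \<Longrightarrow> F u v"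
  shows "has_matching F m X"
  using assms
proof (induction m arbitrary: W X)
  case (Suc m)
  from Suc.prems(1) obtain u v where uv: "u \<in> W" "v \<in> W" "u \<noteq> v" "E u v"
    "has_matching E m (W - {u, v})"
    by auto
  have "has_matching F m (X - {u, v})"
    using uv(5) by (rule Suc.IH) (use Suc.prems in auto)
  moreover have "u \<in> X" "v \<in> X" "F u v"
    using uv Suc.prems by auto
  ultimately show ?case
    using uv(3) by auto
qed simp

lemma has_matching_SucI:
  assumes "u \<in> W" "v \<in> W" "u \<noteq> v" "E u v" "has_matching E m X" "X \<subseteq> W - {u, v}"
  shows "has_matching E (Suc m) W"
  using assms has_matching_mono[of E m X "W - {u, v}" E] by auto

lemma has_two_matchingsI:
  assumes "has_matching E a W" "has_matching (\<lambda>u v. \<not> E u v) b W"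
  shows "has_two_matchings E (a + b) W"
  using assms by (auto simp: has_two_matchings_def)

lemma has_two_matchings_swap:
  "has_two_matchings (\<lambda>u v. \<not> E u v) k W \<longleftrightarrow> has_two_matchings E k W"
  unfolding has_two_matchings_def by (auto, (metis add.commute)+)

lemma has_matching_clique:
  assumes "finite W" "spanning_clique E W"
  shows "has_matching E (card W div 2) W"
  using assms
proof (induction "card W div 2" arbitrary: W)
  case (Suc m)
  then have "card W \<ge> 2"
    by linarith
  then obtain u v where uv: "u \<in> W" "v \<in> W" "u \<noteq> v"
    by (metis card_2_iff' obtain_subset_with_card_n subsetD)
  have "m = card (W - {u, v}) div 2"
    using Suc.hyps(2) uv Suc.prems(1) by (simp add: card_Diff_subset)
  moreover have "spanning_clique E (W - {u, v})"
    using Suc.prems(2) by (auto simp: spanning_clique_def)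
  ultimately have "has_matching E m (W - {u, v})"
    using Suc.hyps(1)[of "W - {u, v}"] Suc.prems(1) by simp
  then have "has_matching E (Suc m) W"
    using uv Suc.prems(2) by (auto simp: spanning_clique_def)
  then show ?case
    using Suc.hyps(2) by simp
qed (metis has_matching.simps(1))

text \<open>Any two vertices form an edge of one of the colours, so a pairing of the vertices suffices.\<close>

lemma two_matchings_half:
  assumes "finite W"
  shows "has_two_matchings E (card W div 2) W"
  using assms
proof (induction "card W div 2" arbitrary: W)
  case 0
  then show ?case
    by (metis add_0 has_matching.simps(1) has_two_matchingsI)
next
  case (Suc m)
  then have "card W \<ge> 2"
    by linarith
  then obtain u v where uv: "u \<in> W" "v \<in> W" "u \<noteq> v"
    by (metis card_2_iff' obtain_subset_with_card_n subsetD)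
  have "m = card (W - {u, v}) div 2"
    using Suc.hyps(2) uv Suc.prems(1) by (simp add: card_Diff_subset)
  then have "has_two_matchings E m (W - {u, v})"
    using Suc.hyps(1)[of "W - {u, v}"] Suc.prems(1) by simp
  then obtain a b where ab: "a + b = m" "has_matching E a (W - {u, v})"
    "has_matching (\<lambda>u v. \<not> E u v) b (W - {u, v})"
    by (auto simp: has_two_matchings_def)
  have mono: "has_matching F k W" if "has_matching F k (W - {u, v})" for F k
    using that by (rule has_matching_mono) auto
  have "has_two_matchings E (Suc m) W"
  proof (cases "E u v")
    case True
    then have "has_matching E (Suc a) W"
      using uv ab(2) by auto
    then show ?thesis
      using has_two_matchingsI mono[OF ab(3)] ab(1) by fastforce
  next
    case False
    then have "has_matching (\<lambda>u v. \<not> E u v) (Suc b) W"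
      using uv ab(3) by auto
    then show ?thesis
      using has_two_matchingsI[OF mono[OF ab(2)]] ab(1) by fastforce
  qed
  then show ?case
    using Suc.hyps(2) by simp
qed

section \<open>Gaining from a vertex that meets both colours\<close>

text \<open>
  Take a red edge and a blue edge. If they are disjoint, any edge between them meets one of them
  in a vertex where the colours differ.
\<close>

lemma mixed_vertex:
  assumes sym: "\<And>u v. E u v = E v u"
    and "\<not> spanning_clique E W" "\<not> spanning_clique (\<lambda>u v. \<not> E u v) W"
  obtains v x y where "v \<in> W" "x \<in> W" "y \<in> W" "v \<noteq> x" "v \<noteq> y" "x \<noteq> y" "E v x" "\<not> E v y"
proof -
  obtain p q where pq: "p \<in> W" "q \<in> W" "p \<noteq> q" "\<not> E p q"
    using assms(2) by (auto simp: spanning_clique_def)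
  obtain s t where st: "s \<in> W" "t \<in> W" "s \<noteq> t" "E s t"
    using assms(3) by (auto simp: spanning_clique_def)
  show thesis
  proof (cases "s = p")
    case True
    then show thesis using that[of p t q] pq st by metis
  next
    case False
    then show thesis
      using that[of p s q] that[of s t p] pq st sym by metis
  qed
qed

text \<open>The two new edges share the vertex \<open>v\<close>, which is harmless as they join different matchings.\<close>

lemma two_matchings_add_mixed_vertex:
  assumes "v \<in> W" "x \<in> W" "y \<in> W" "v \<noteq> x" "v \<noteq> y" "E v x" "\<not> E v y"
    and "has_two_matchings E k (W - {v, x, y})"
  shows "has_two_matchings E (k + 2) W"
proof -
  obtain a b where ab: "a + b = k" "has_matching E a (W - {v, x, y})"
    "has_matching (\<lambda>u v. \<not> E u v) b (W - {v, x, y})"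
    using assms(8) by (auto simp: has_two_matchings_def)
  have "has_matching E (Suc a) W"
    by (rule has_matching_SucI[OF _ _ _ _ ab(2)]) (use assms in auto)
  moreover have "has_matching (\<lambda>u v. \<not> E u v) (Suc b) W"
    by (rule has_matching_SucI[OF _ _ _ _ ab(3)]) (use assms in auto)
  ultimately show ?thesis
    using has_two_matchingsI[of E "Suc a" W "Suc b"] ab(1) by simp
qed

text \<open>
  For odd order the remaining \<open>card W - 3\<close> vertices can be paired off completely, so that no
  vertex is wasted and the mixed vertex yields a net gain.
\<close>

lemma mixed_large_matchings_odd:
  assumes sym: "\<And>u v. E u v = E v u" and "finite W" "odd (card W)"
    and "\<not> spanning_clique E W" "\<not> spanning_clique (\<lambda>u v. \<not> E u v) W"
  shows "\<exists>k. has_two_matchings E k W \<and> card W < 2 * k"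
proof -
  obtain v x y where *: "v \<in> W" "x \<in> W" "y \<in> W" "v \<noteq> x" "v \<noteq> y" "x \<noteq> y" "E v x" "\<not> E v y"
    using mixed_vertex[OF sym assms(4,5)] by metis
  define m where "m = card (W - {v, x, y}) div 2"
  have "card (W - {v, x, y}) = card W - 3"
    using * assms(2) by (simp add: card_Diff_subset)
  moreover have "card {v, x, y} \<le> card W"
    using * assms(2) by (intro card_mono) auto
  then have "card W \<ge> 3"
    using * by simp
  ultimately have "card W < 2 * (m + 2)"
    unfolding m_def using assms(3) by presburger
  moreover have "has_two_matchings E (m + 2) W"
    unfolding m_def
    by (rule two_matchings_add_mixed_vertex[where E = E, OF *(1-5,7,8)])
      (rule two_matchings_half, use assms(2) in simp)
  ultimately show ?thesis
    by blast
qed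

text \<open>
  Here the mixed vertex \<open>v\<close> and its neighbours \<open>x\<close> and \<open>y\<close> leave a red clique \<open>R\<close> of odd size. Since
  any vertex of \<open>R\<close> may be left out of a maximum red matching of \<open>R\<close>, a red edge within \<open>{v, x, y}\<close>
  and a red edge from the third of these vertices to \<open>R\<close> extend to a perfect red matching, which
  together with the blue edge \<open>vy\<close> is good enough. Likewise two disjoint blue edges are good enough together with \<open>vx\<close> and a
  maximum matching of \<open>R\<close>. If neither is available, then \<open>y\<close> is the centre of a blue star, the only
  alternative being a red star with centre \<open>x\<close> on four vertices.
\<close>

lemma mixed_vertex_over_clique:
  assumes sym: "\<And>u v. E u v = E v u" and fin: "finite W" and even: "even (card W)"
    and V: "v \<in> W" "x \<in> W" "y \<in> W" "v \<noteq> x" "v \<noteq> y" "x \<noteq> y" "E v x" "\<not> E v y"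
    and clique: "spanning_clique E (W - {v, x, y})"
  shows "(\<exists>k. has_two_matchings E k W \<and> card W < 2 * k) \<or>
    spanning_star E W \<or> spanning_star (\<lambda>u v. \<not> E u v) W"
proof (rule ccontr)
  assume contra: "\<not> ?thesis"
  then have small: "2 * (a + b) \<le> card W"
    if "has_matching E a W" "has_matching (\<lambda>u v. \<not> E u v) b W" for a b
    using has_two_matchingsI[OF that] by (meson not_le_imp_less)
  have no_stars: "\<not> spanning_star E W" "\<not> spanning_star (\<lambda>u v. \<not> E u v) W"
    using contra by auto
  define R where "R = W - {v, x, y}"
  have W: "W = insert v (insert x (insert y R))" and R: "v \<notin> R" "x \<notin> R" "y \<notin> R" "finite R"
    using V fin by (auto simp: R_def)
  have card_W: "card W = card R + 3"
    using V R by (simp add: W)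
  have RR: "E r s" if "r \<in> R" "s \<in> R" "r \<noteq> s" for r s
    using clique that by (auto simp: R_def spanning_clique_def)
  have no_perfect: "\<not> (E p q \<and> E s r)"
    if "{p, q, s} = {v, x, y}" "p \<noteq> q" "s \<noteq> p" "s \<noteq> q" "r \<in> R" for p q s r
  proof
    assume red: "E p q \<and> E s r"
    have "spanning_clique E (R - {r})"
      using RR by (auto simp: spanning_clique_def)
    then have m: "has_matching E (card (R - {r}) div 2) (R - {r})"
      using has_matching_clique R by blast
    have pqs: "p \<in> {v, x, y}" "q \<in> {v, x, y}" "s \<in> {v, x, y}"
      using that(1) by blast+
    then have "p \<notin> R" "q \<notin> R" "s \<notin> R"
      using R by auto
    have "has_matching E (Suc (card (R - {r}) div 2)) (W - {p, q})"
      by (rule has_matching_SucI[OF _ _ _ _ m, of s _ r])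
        (use that pqs red R \<open>p \<notin> R\<close> \<open>q \<notin> R\<close> \<open>s \<notin> R\<close> in \<open>auto simp: W\<close>)
    then have "has_matching E (Suc (Suc (card (R - {r}) div 2))) W"
      using red pqs that(2) V(1-3) by auto
    moreover have "has_matching (\<lambda>u v. \<not> E u v) 1 W"
      using V by auto
    ultimately have "2 * (Suc (Suc (card (R - {r}) div 2)) + 1) \<le> card W"
      by (rule small)
    moreover have "card (R - {r}) = card R - 1" "card R > 0"
      using that(5) R by (auto simp: card_gt_0_iff)
    ultimately show False
      using card_W even by presburger
  qed
  have no_two_blue: "\<not> (\<not> E p q \<and> \<not> E s t)"
    if "p \<in> W" "q \<in> W" "s \<in> W" "t \<in> W" "p \<noteq> q" "s \<noteq> t" "{p, q} \<inter> {s, t} = {}" for p q s t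
  proof
    assume blue: "\<not> E p q \<and> \<not> E s t"
    have "has_matching (\<lambda>u v. \<not> E u v) (Suc (Suc 0)) W"
      using that blue by auto
    moreover have "has_matching E (card R div 2) R"
      using has_matching_clique RR R by (auto simp: spanning_clique_def)
    then have "has_matching E (Suc (card R div 2)) W"
      by (rule has_matching_SucI[of v _ x, rotated 4]) (use V R in \<open>auto simp: W\<close>)
    ultimately have "2 * (Suc (card R div 2) + Suc (Suc 0)) \<le> card W"
      by (intro small)
    then show False
      using card_W even by presburger
  qed
  have yR: "\<not> E y r" if "r \<in> R" for r
    using no_perfect[of v x y r] V that by auto
  have xR: "E x r" if "r \<in> R" for r
    using no_two_blue[of v y x r] V R that by (auto simp: W)
  show False
  proof (cases "\<forall>r\<in>R. E v r")
    case True
    have "card R \<noteq> 0"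
      using card_W even by presburger
    then obtain r where "r \<in> R"
      by fastforce
    then have "\<not> E x y"
      using no_perfect[of x y v r] V True by auto
    then have "spanning_star (\<lambda>u v. \<not> E u v) W"
      unfolding spanning_star_def using V yR xR True RR sym
      by (intro bexI[of _ y]) (auto simp: W)
    then show False
      using no_stars by simp
  next
    case False
    then obtain r where r: "r \<in> R" "\<not> E v r"
      by blast
    have "s = r" if "s \<in> R" for s
    proof (rule ccontr)
      assume "s \<noteq> r"
      moreover have "r \<in> W" "s \<in> W" "y \<noteq> r" "y \<noteq> s" "v \<noteq> r" "v \<noteq> s"
        using r that by (auto simp: R_def)
      ultimately have "\<not> (\<not> E v r \<and> \<not> E y s)"
        using V by (intro no_two_blue) auto
      then show False
        using r yR[OF that] by simp
    qed
    then have "R = {r}"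
      using r(1) by blast
    moreover have "E y x"
      using no_two_blue[of v r y x] V R r by (auto simp: W)
    then have "E x y"
      by (simp only: sym)
    moreover have "\<not> E r v" "\<not> E r y" "\<not> E y v" "E x v" "E r x"
      using V(7,8) r(2) yR[OF r(1)] xR[OF r(1)] sym by blast+
    ultimately have "spanning_star E W"
      unfolding spanning_star_def using V yR xR r \<open>E y x\<close>
      by (intro bexI[of _ x]) (auto simp: W)
    then show False
      using no_stars by simp
  qed
qed

text \<open>
  For even order the remaining \<open>card W - 3\<close> vertices are odd in number, so the odd case applies to
  them unless they are monochromatic; exchanging the colours makes them a red clique.
\<close>

lemma mixed_large_matchings_even:
  assumes sym: "\<And>u v. E u v = E v u" and fin: "finite W" and even: "even (card W)"
    and "\<not> spanning_clique E W" "\<not> spanning_clique (\<lambda>u v. \<not> E u v) W"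
  shows "(\<exists>k. has_two_matchings E k W \<and> card W < 2 * k) \<or>
    spanning_star E W \<or> spanning_star (\<lambda>u v. \<not> E u v) W"
proof -
  obtain v x y where V: "v \<in> W" "x \<in> W" "y \<in> W" "v \<noteq> x" "v \<noteq> y" "x \<noteq> y" "E v x" "\<not> E v y"
    using mixed_vertex[OF sym assms(4,5)] by metis
  let ?R = "W - {v, x, y}"
  consider "spanning_clique E ?R" | "spanning_clique (\<lambda>u v. \<not> E u v) ?R"
    | "\<not> spanning_clique E ?R" "\<not> spanning_clique (\<lambda>u v. \<not> E u v) ?R"
    by blast
  then show ?thesis
  proof cases
    case 1
    then show ?thesis
      using mixed_vertex_over_clique[of E W v x y] sym fin even V by blast
  next
    case 2
    have "W - {v, y, x} = ?R"
      by auto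
    then show ?thesis
      using mixed_vertex_over_clique[of "\<lambda>u v. \<not> E u v" W v y x] sym fin even V 2
      by (auto simp: has_two_matchings_swap)
  next
    case 3
    have "card ?R = card W - 3"
      using V fin by (simp add: card_Diff_subset)
    moreover have "card {v, x, y} \<le> card W"
      using V fin by (intro card_mono) auto
    then have "card W \<ge> 3"
      using V by simp
    ultimately have card: "card W = card ?R + 3"
      by simp
    then have "odd (card ?R)"
      using even by simp
    then obtain k where k: "has_two_matchings E k ?R" "card ?R < 2 * k"
      using mixed_large_matchings_odd[of E ?R] sym fin 3 by blast
    have "card W < 2 * (k + 2)"
      using k card by simp
    then show ?thesis
      using two_matchings_add_mixed_vertex[where E = E, OF V(1-5,7,8) k(1)] by blast
  qed
qed

section \<open>Colourings from matchings in the complement\<close>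

lemma colouring_from_matching:
  assumes sym: "\<And>u v. E u v = E v u" and "finite W" "has_matching E m W"
  shows "\<exists>c :: 'a \<Rightarrow> nat. card (c ` W) + m \<le> card W \<and> (\<forall>i. card {u \<in> W. c u = i} \<le> 2) \<and>
    (\<forall>u\<in>W. \<forall>v\<in>W. u \<noteq> v \<longrightarrow> c u = c v \<longrightarrow> E u v)"
  using assms(2,3)
proof (induction m arbitrary: W)
  case 0
  obtain c :: "'a \<Rightarrow> nat" where inj: "inj_on c W"
    using finite_imp_inj_to_nat_seg[OF 0(1)] by blast
  have "card {u \<in> W. c u = i} \<le> 2" for i
  proof -
    have "card {u \<in> W. c u = i} \<le> card {i}"
      by (rule card_inj_on_le[of c]) (auto intro: inj_on_subset[OF inj])
    then show ?thesis by simp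
  qed
  then show ?case
    using inj by (intro exI[of _ c]) (auto simp: card_image dest: inj_onD)
next
  case (Suc m)
  obtain p q where pq: "p \<in> W" "q \<in> W" "p \<noteq> q" "E p q" "has_matching E m (W - {p, q})"
    using Suc.prems(2) by auto
  define X where "X = W - {p, q}"
  have W: "W = insert p (insert q X)" "p \<notin> X" "q \<notin> X" "finite X"
    using pq Suc.prems(1) by (auto simp: X_def)
  have "has_matching E m X"
    using pq(5) by (simp only: X_def)
  from Suc.IH[OF W(4) this] obtain c :: "'a \<Rightarrow> nat" where c: "card (c ` X) + m \<le> card X"
    "\<And>i. card {u \<in> X. c u = i} \<le> 2" "\<And>u v. u \<in> X \<Longrightarrow> v \<in> X \<Longrightarrow> u \<noteq> v \<Longrightarrow> c u = c v \<Longrightarrow> E u v"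
    by blast
  obtain k where k: "k \<notin> c ` X"
    using W(4) ex_new_if_finite[of "c ` X"] by auto
  define d where "d = (\<lambda>u. if u \<in> X then c u else k)"
  have "d ` W = insert k (c ` X)"
    using W by (auto simp: d_def)
  then have "card (d ` W) + Suc m \<le> card W"
    using c(1) k W pq(3) by simp
  moreover have "card {u \<in> W. d u = i} \<le> 2" for i
  proof (cases "i = k")
    case True
    then have "{u \<in> W. d u = i} = {p, q}"
      using W k by (auto simp: d_def)
    then show ?thesis
      using pq(3) by simp
  next
    case False
    then have "{u \<in> W. d u = i} = {u \<in> X. c u = i}"
      using W by (auto simp: d_def)
    then show ?thesis
      using c(2) by simp
  qed
  moreover have "E u v" if "u \<in> W" "v \<in> W" "u \<noteq> v" "d u = d v" for u v
    using that k c(3) pq(4) sym W by (auto simp: d_def split: if_splits)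
  ultimately show ?case
    by blast
qed

lemma two_frugal_chromatic_number_le:
  fixes c :: "'a \<Rightarrow> nat"
  assumes "two_frugal_coloring G c"
  shows "two_frugal_chromatic_number G \<le> card (c ` pverts G)"
  unfolding two_frugal_chromatic_number_def by (rule Least_le) (use assms in blast)

lemma pair_graph_basic:
  assumes "pair_graph G"
  shows "finite (pverts G)" "\<And>u v. (u, v) \<in> parcs G \<longleftrightarrow> (v, u) \<in> parcs G"
    "\<And>u v. (u, v) \<in> parcs G \<Longrightarrow> u \<in> pverts G \<and> v \<in> pverts G \<and> u \<noteq> v"
proof -
  interpret pair_graph G by fact
  show "finite (pverts G)"
    by (rule pair_finite_verts)
  show "\<And>u v. (u, v) \<in> parcs G \<longleftrightarrow> (v, u) \<in> parcs G"
    using sym_arcs by (auto simp: symmetric_def sym_def)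
  show "\<And>u v. (u, v) \<in> parcs G \<Longrightarrow> u \<in> pverts G \<and> v \<in> pverts G \<and> u \<noteq> v"
    using in_arcsD1 in_arcsD2 pair_no_loops by fastforce
qed

text \<open>
  Colour classes of size at most two make frugality automatic, whatever the neighbourhoods are.
\<close>

lemma two_frugal_chromatic_number_matching:
  assumes "pair_graph G" "has_matching (\<lambda>u v. (u, v) \<notin> parcs G) m (pverts G)"
  shows "two_frugal_chromatic_number G + m \<le> card (pverts G)"
proof -
  note G = pair_graph_basic[OF assms(1)]
  have "\<And>u v. ((u, v) \<notin> parcs G) = ((v, u) \<notin> parcs G)"
    using G(2) by blast
  from colouring_from_matching[OF this G(1) assms(2)]
  obtain c :: "'a \<Rightarrow> nat" where c: "card (c ` pverts G) + m \<le> card (pverts G)"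
    "\<And>i. card {u \<in> pverts G. c u = i} \<le> 2"
    "\<And>u v. u \<in> pverts G \<Longrightarrow> v \<in> pverts G \<Longrightarrow> u \<noteq> v \<Longrightarrow> c u = c v \<Longrightarrow> (u, v) \<notin> parcs G"
    by blast
  have "card {u \<in> neighborhood G v. c u = i} \<le> card {u \<in> pverts G. c u = i}" for v i
    using G(1) by (intro card_mono) (auto simp: neighborhood_def)
  then have "card {u \<in> neighborhood G v. c u = i} \<le> 2" for v i
    using c(2) order_trans by blast
  moreover have "proper_coloring G c"
    using c(3) G(3) by (auto simp: proper_coloring_def)
  ultimately have "two_frugal_coloring G c"
    by (simp add: two_frugal_coloring_def)
  then show ?thesis
    using two_frugal_chromatic_number_le c(1) by fastforce
qed

lemma two_frugal_chromatic_number_edgeless: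
  assumes "parcs G = {}"
  shows "two_frugal_chromatic_number G \<le> 1"
proof -
  have "two_frugal_coloring G (\<lambda>_. 0 :: nat)"
    using assms by (simp add: two_frugal_coloring_def proper_coloring_def neighborhood_def)
  moreover have "card ((\<lambda>_. 0 :: nat) ` pverts G) \<le> card {0 :: nat}"
    by (intro card_mono) auto
  ultimately show ?thesis
    using two_frugal_chromatic_number_le by fastforce
qed

lemma pverts_graph_complement [simp]: "pverts (graph_complement G) = pverts G"
  by (simp add: graph_complement_def)

lemma parcs_graph_complement_iff:
  "(u, v) \<in> parcs (graph_complement G) \<longleftrightarrow>
     u \<in> pverts G \<and> v \<in> pverts G \<and> u \<noteq> v \<and> (u, v) \<notin> parcs G"
  by (simp add: graph_complement_def)

lemma graph_complement_involutive:
  assumes "pair_graph G"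
  shows "graph_complement (graph_complement G) = G"
  using pair_graph_basic(3)[OF assms]
  by (intro pair_pre_digraph.equality) (auto simp: graph_complement_def)

lemma sum_le_of_two_matchings:
  assumes "pair_graph G" "has_two_matchings (\<lambda>u v. (u, v) \<in> parcs G) k (pverts G)"
  shows "two_frugal_chromatic_number G + two_frugal_chromatic_number (graph_complement G) + k
    \<le> 2 * card (pverts G)"
proof -
  obtain a b where ab: "a + b = k" "has_matching (\<lambda>u v. (u, v) \<in> parcs G) a (pverts G)"
    "has_matching (\<lambda>u v. (u, v) \<notin> parcs G) b (pverts G)"
    using assms(2) by (auto simp: has_two_matchings_def)
  have "has_matching (\<lambda>u v. (u, v) \<notin> parcs (graph_complement G)) a (pverts G)"
    using ab(2) by (rule has_matching_mono) (auto simp: parcs_graph_complement_iff)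
  then have "two_frugal_chromatic_number (graph_complement G) + a \<le> card (pverts G)"
    using two_frugal_chromatic_number_matching[OF pair_graph_complement[OF assms(1)]] by simp
  then show ?thesis
    using two_frugal_chromatic_number_matching[OF assms(1) ab(3)] ab(1) by simp
qed

lemma sum_le_of_edgeless:
  assumes "pair_graph G" "parcs G = {} \<or> parcs (graph_complement G) = {}"
  shows "two_frugal_chromatic_number G + two_frugal_chromatic_number (graph_complement G)
    \<le> card (pverts G) + 1"
proof -
  have "two_frugal_chromatic_number G \<le> card (pverts G)"
    using two_frugal_chromatic_number_matching[OF assms(1), of 0] by simp
  moreover have "two_frugal_chromatic_number (graph_complement G) \<le> card (pverts G)"
    using two_frugal_chromatic_number_matching[OF pair_graph_complement[OF assms(1)], of 0] by simp
  ultimately show ?thesis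
    using assms(2) two_frugal_chromatic_number_edgeless[of G]
      two_frugal_chromatic_number_edgeless[of "graph_complement G"] by auto
qed

section \<open>Stars\<close>

lemma star_graph_iso_iff:
  assumes "pair_graph G" "card (pverts G) = n" "n \<ge> 2"
  shows "graph_isomorphic G (star_graph (n - 1)) \<longleftrightarrow>
    spanning_star (\<lambda>u v. (u, v) \<in> parcs G) (pverts G)"
proof -
  note G = pair_graph_basic[OF assms(1)]
  have star: "(i, j) \<in> parcs (star_graph m) \<longleftrightarrow> i \<noteq> j \<and> (i = 0 \<or> j = 0)" if "i \<le> m" "j \<le> m"
    for i j m
    using that by (auto simp: star_graph_def)
  have verts: "pverts (star_graph m) = {0..m}" for m
    by (simp add: star_graph_def)
  show ?thesis
    unfolding graph_isomorphic_iff[OF assms(1) pair_graph_star]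
  proof
    assume "\<exists>f. bij_betw f (pverts G) (pverts (star_graph (n - 1))) \<and>
      (\<forall>u \<in> pverts G. \<forall>v \<in> pverts G. (u, v) \<in> parcs G \<longleftrightarrow> (f u, f v) \<in> parcs (star_graph (n - 1)))"
    then obtain f where f: "bij_betw f (pverts G) {0..n - 1}"
      and e: "\<And>u v. u \<in> pverts G \<Longrightarrow> v \<in> pverts G \<Longrightarrow>
        (u, v) \<in> parcs G \<longleftrightarrow> (f u, f v) \<in> parcs (star_graph (n - 1))"
      by (auto simp: verts)
    have inj: "\<And>u v. u \<in> pverts G \<Longrightarrow> v \<in> pverts G \<Longrightarrow> f u = f v \<longleftrightarrow> u = v"
      using f by (auto simp: bij_betw_def inj_on_eq_iff)
    have le: "\<And>u. u \<in> pverts G \<Longrightarrow> f u \<le> n - 1"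
      using f by (auto simp: bij_betw_def)
    have "0 \<in> f ` pverts G"
      using f by (simp add: bij_betw_def)
    then obtain z where z: "z \<in> pverts G" "f z = 0"
      by auto
    then have "f u = 0 \<longleftrightarrow> u = z" if "u \<in> pverts G" for u
      using inj[OF that z(1)] by simp
    then show "spanning_star (\<lambda>u v. (u, v) \<in> parcs G) (pverts G)"
      unfolding spanning_star_def using z(1) e star[OF le le] inj by (intro bexI[of _ z]) auto
  next
    assume "spanning_star (\<lambda>u v. (u, v) \<in> parcs G) (pverts G)"
    then obtain z where z: "z \<in> pverts G" and e: "\<And>u v. u \<in> pverts G \<Longrightarrow> v \<in> pverts G \<Longrightarrow> u \<noteq> v \<Longrightarrow>
      (u, v) \<in> parcs G \<longleftrightarrow> u = z \<or> v = z"
      unfolding spanning_star_def by blast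
    have "card (pverts G - {z}) = card {1..n - 1}"
      using z G(1) assms(2) by simp
    then obtain g where g: "bij_betw g (pverts G - {z}) {1..n - 1}"
      using G(1) finite_same_card_bij by blast
    define f where "f = g(z := 0)"
    have "bij_betw f (pverts G - {z}) {1..n - 1}"
      using g by (simp add: f_def bij_betw_def inj_on_def image_def)
    then have "bij_betw f ((pverts G - {z}) \<union> {z}) ({1..n - 1} \<union> {f z})"
      by (intro notIn_Un_bij_betw) (auto simp: f_def)
    moreover have "(pverts G - {z}) \<union> {z} = pverts G"
      using z by auto
    moreover have "{1..n - 1} \<union> {f z} = {0..n - 1}"
      by (auto simp: f_def)
    ultimately have f: "bij_betw f (pverts G) {0..n - 1}"
      by simp
    have inj: "\<And>u v. u \<in> pverts G \<Longrightarrow> v \<in> pverts G \<Longrightarrow> f u = f v \<longleftrightarrow> u = v"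
      using f by (auto simp: bij_betw_def inj_on_eq_iff)
    have le: "\<And>u. u \<in> pverts G \<Longrightarrow> f u \<le> n - 1"
      using f by (auto simp: bij_betw_def)
    have zero: "f u = 0 \<longleftrightarrow> u = z" if "u \<in> pverts G" for u
      using inj[OF that z] by (simp add: f_def)
    have "(u, v) \<in> parcs G \<longleftrightarrow> (f u, f v) \<in> parcs (star_graph (n - 1))"
      if "u \<in> pverts G" "v \<in> pverts G" for u v
      using that e[OF that] star[OF le le, OF that] inj[OF that] zero[OF that(1)] zero[OF that(2)]
        G(3)[of u v] by auto
    then show "\<exists>f. bij_betw f (pverts G) (pverts (star_graph (n - 1))) \<and>
      (\<forall>u \<in> pverts G. \<forall>v \<in> pverts G. (u, v) \<in> parcs G \<longleftrightarrow> (f u, f v) \<in> parcs (star_graph (n - 1)))"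
      using f by (intro exI[of _ f]) (auto simp: verts)
  qed
qed

lemma graph_iso_complement:
  assumes "pair_graph G" "pair_graph H"
  shows "graph_isomorphic G (graph_complement H) \<longleftrightarrow> graph_isomorphic (graph_complement G) H"
proof -
  have "(\<forall>u \<in> pverts G. \<forall>v \<in> pverts G. (u, v) \<in> parcs G \<longleftrightarrow> (f u, f v) \<in> parcs (graph_complement H)) \<longleftrightarrow>
    (\<forall>u \<in> pverts G. \<forall>v \<in> pverts G. (u, v) \<in> parcs (graph_complement G) \<longleftrightarrow> (f u, f v) \<in> parcs H)"
    if "bij_betw f (pverts G) (pverts H)" for f
  proof -
    have inj: "\<And>u v. u \<in> pverts G \<Longrightarrow> v \<in> pverts G \<Longrightarrow> f u = f v \<longleftrightarrow> u = v"
      and "\<And>u. u \<in> pverts G \<Longrightarrow> f u \<in> pverts H"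
      using that by (auto simp: bij_betw_def inj_on_eq_iff)
    then show ?thesis
      using pair_graph_basic(3)[OF assms(1)] pair_graph_basic(3)[OF assms(2)]
      unfolding parcs_graph_complement_iff by (intro ball_cong refl) metis
  qed
  then show ?thesis
    unfolding graph_isomorphic_iff[OF assms(1) pair_graph_complement[OF assms(2)]]
      graph_isomorphic_iff[OF pair_graph_complement[OF assms(1)] assms(2)] pverts_graph_complement
    by (intro ex_cong1 conj_cong refl)
qed

lemma costar_graph_iso_iff:
  assumes "pair_graph G" "card (pverts G) = n" "n \<ge> 2"
  shows "graph_isomorphic G (graph_complement (star_graph (n - 1))) \<longleftrightarrow>
    spanning_star (\<lambda>u v. (u, v) \<notin> parcs G) (pverts G)"
  using star_graph_iso_iff[OF pair_graph_complement[OF assms(1)]] assms(2,3)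
  by (simp add: graph_iso_complement[OF assms(1) pair_graph_star] parcs_graph_complement_iff
      spanning_star_def cong: ball_cong)

text \<open>
  All leaves lie in the neighbourhood of the centre, where no colour occurs three times; and they
  are pairwise adjacent in the complement.
\<close>

lemma sum_ge_of_star:
  assumes "pair_graph G" "even (card (pverts G))"
    and "spanning_star (\<lambda>u v. (u, v) \<in> parcs G) (pverts G)"
  shows "3 * card (pverts G) \<le>
    2 * (two_frugal_chromatic_number G + two_frugal_chromatic_number (graph_complement G))"
proof -
  note G = pair_graph_basic[OF assms(1)]
  obtain z where z: "z \<in> pverts G" and e: "\<And>u v. u \<in> pverts G \<Longrightarrow> v \<in> pverts G \<Longrightarrow> u \<noteq> v \<Longrightarrow>
    (u, v) \<in> parcs G \<longleftrightarrow> u = z \<or> v = z"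
    using assms(3) unfolding spanning_star_def by blast
  define L where "L = pverts G - {z}"
  have L: "pverts G = insert z L" "z \<notin> L" "finite L"
    using z G(1) by (auto simp: L_def)
  have nbhd: "neighborhood G z = L"
    using e[OF z] G(3)[of z z] by (auto simp: L_def neighborhood_def)
  have card: "card (pverts G) = card L + 1"
    using L by simp
  obtain c :: "'a \<Rightarrow> nat" where c: "two_frugal_coloring G c"
    "card (c ` pverts G) = two_frugal_chromatic_number G"
    using two_frugal_chromatic_number_attained[OF assms(1)] by blast
  have "card L = (\<Sum>i\<in>c ` L. card {u \<in> L. c u = i})"
    unfolding card_eq_sum by (rule sum.image_gen[OF L(3)])
  also have "\<dots> \<le> (\<Sum>i\<in>c ` L. 2)"
    using c(1) z nbhd by (intro sum_mono) (auto simp: two_frugal_coloring_def)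
  finally have "card L \<le> 2 * card (c ` L)"
    by simp
  moreover have "(z, u) \<in> parcs G" if "u \<in> L" for u
    using that nbhd by (auto simp: neighborhood_def)
  then have "c z \<notin> c ` L"
    using c(1) by (fastforce simp: two_frugal_coloring_def proper_coloring_def)
  then have "card (c ` pverts G) = card (c ` L) + 1"
    using L by simp
  ultimately have "card L + 2 \<le> 2 * two_frugal_chromatic_number G"
    using c(2) by simp
  obtain d :: "'a \<Rightarrow> nat" where d: "two_frugal_coloring (graph_complement G) d"
    "card (d ` pverts G) = two_frugal_chromatic_number (graph_complement G)"
    using two_frugal_chromatic_number_attained[OF pair_graph_complement[OF assms(1)]] by auto
  have "(u, v) \<in> parcs (graph_complement G)" if "u \<in> L" "v \<in> L" "u \<noteq> v" for u v
    using that e[of u v] by (auto simp: parcs_graph_complement_iff L_def)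
  then have "inj_on d L"
    using d(1) by (intro inj_onI) (fastforce simp: two_frugal_coloring_def proper_coloring_def)
  then have "card L = card (d ` L)"
    by (simp add: card_image)
  also have "\<dots> \<le> card (d ` pverts G)"
    using L G(1) by (intro card_mono) auto
  finally have "card L \<le> two_frugal_chromatic_number (graph_complement G)"
    using d(2) by simp
  \<comment> \<open>As \<open>card L\<close> is odd, the first bound improves to \<open>card L + 3\<close>.\<close>
  moreover have "card L + 3 \<le> 2 * two_frugal_chromatic_number G"
    using \<open>card L + 2 \<le> _\<close> assms(2) card by presburger
  ultimately show ?thesis
    using card by simp
qed

section \<open>The Nordhaus-Gaddum bound\<close>

theorem theorem5p2:
  fixes G :: "'a pair_pre_digraph" and n :: nat
  assumes "pair_graph G"
    and "card (pverts G) = n"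
    and "n \<ge> 2"
  shows "real (two_frugal_chromatic_number G)
           + real (two_frugal_chromatic_number (graph_complement G)) \<le> 3 * real n / 2
       \<and> (real (two_frugal_chromatic_number G)
           + real (two_frugal_chromatic_number (graph_complement G)) = 3 * real n / 2
         \<longleftrightarrow> even n \<and>
             (graph_isomorphic G (star_graph (n - 1))
              \<or> graph_isomorphic G (graph_complement (star_graph (n - 1)))))"
proof -
  note G = pair_graph_basic[OF assms(1)]
  let ?E = "\<lambda>u v. (u, v) \<in> parcs G"
  let ?F = "\<lambda>u v. (u, v) \<notin> parcs G"
  let ?V = "pverts G"
  define s where "s = two_frugal_chromatic_number G + two_frugal_chromatic_number (graph_complement G)"
  have large: "2 * s < 3 * n" if "has_two_matchings ?E k ?V" "n < 2 * k" for k
    using sum_le_of_two_matchings[OF assms(1) that(1)] that(2) assms(2) by (simp add: s_def)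
  have trivial: "2 * s < 3 * n \<or> n = 2" if "spanning_clique ?E ?V \<or> spanning_clique ?F ?V"
  proof -
    from that have "parcs G = {} \<or> parcs (graph_complement G) = {}"
    proof
      assume "spanning_clique ?E ?V"
      then have "(u, v) \<notin> parcs (graph_complement G)" for u v
        by (auto simp: spanning_clique_def parcs_graph_complement_iff)
      then show ?thesis
        by auto
    next
      assume "spanning_clique ?F ?V"
      then have "(u, v) \<notin> parcs G" for u v
        using G(3) unfolding spanning_clique_def by blast
      then show ?thesis
        by auto
    qed
    then have "s \<le> n + 1"
      using sum_le_of_edgeless[OF assms(1)] assms(2) by (simp add: s_def)
    then show ?thesis
      using assms(3) by linarith
  qed
  have two: "spanning_star ?E ?V \<or> spanning_star ?F ?V" if "n = 2"
  proof -
    obtain p q where "?V = {p, q}" "p \<noteq> q"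
      using \<open>n = 2\<close> assms(2) by (auto simp: card_2_iff)
    then show ?thesis
      using G(2)[of p q] by (auto simp: spanning_star_def)
  qed
  have strict: "2 * s < 3 * n \<or> even n \<and> (spanning_star ?E ?V \<or> spanning_star ?F ?V)"
  proof (cases "spanning_clique ?E ?V \<or> spanning_clique ?F ?V")
    case True
    then show ?thesis
      using trivial two by auto
  next
    case False
    show ?thesis
    proof (cases "even n")
      case True
      then show ?thesis
        using mixed_large_matchings_even[of ?E ?V] G(1,2) False large assms(2) by blast
    next
      case odd: False
      then show ?thesis
        using mixed_large_matchings_odd[of ?E ?V] G(1,2) False large assms(2) by blast
    qed
  qed
  have upper: "2 * s \<le> 3 * n" if "even n"
    using sum_le_of_two_matchings[OF assms(1) two_matchings_half[OF G(1)]] assms(2) that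
    by (simp add: s_def) presburger
  have lower: "3 * n \<le> 2 * s" if "even n" "spanning_star ?E ?V \<or> spanning_star ?F ?V"
    using that(2)
  proof
    assume "spanning_star ?E ?V"
    then show ?thesis
      using sum_ge_of_star[OF assms(1)] that(1) assms(2) by (simp add: s_def)
  next
    assume "spanning_star ?F ?V"
    then have "spanning_star (\<lambda>u v. (u, v) \<in> parcs (graph_complement G)) ?V"
      by (simp add: spanning_star_def parcs_graph_complement_iff cong: ball_cong)
    then show ?thesis
      using sum_ge_of_star[OF pair_graph_complement[OF assms(1)]] that(1) assms(2)
      by (simp add: s_def graph_complement_involutive[OF assms(1)] add.commute)
  qed
  have "2 * s \<le> 3 * n" "2 * s = 3 * n \<longleftrightarrow> even n \<and> (spanning_star ?E ?V \<or> spanning_star ?F ?V)"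
    using strict upper lower by fastforce+
  then have "2 * real s \<le> 3 * real n"
    "2 * real s = 3 * real n \<longleftrightarrow> even n \<and> (spanning_star ?E ?V \<or> spanning_star ?F ?V)"
    by linarith+
  then show ?thesis
    unfolding star_graph_iso_iff[OF assms] costar_graph_iso_iff[OF assms]
    by (auto simp: s_def field_simps)
qed

end
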